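(* For every $n,k\in\mathbb N$ with $n\ge 2k$, $$(k-1)n\le ex_<(n,\neg\text{Nest-}\mathcal M_k)\le ex_<(n,\neg\text{Nest*-}\mathcal M_k)\le (k-1)n+\binom{k-1}{2}.$$
   Context: An ordered graph on $n$ vertices is a graph with vertex set $[n]$ with its natural order. An ordered graph $G$ contains a copy of an ordered graph $H$ if there is an injective, order-preserving map $V(H)\to V(G)$ sending edges to edges. For a family $\mathcal H$ of ordered graphs, $ex_<(n,\mathcal H)$ is the maximum number of edges of an ordered graph on $[n]$ containing no copy of any member of $\mathcal H$. Two vertex-disjoint edges $xy$, $uv$ with $x<y$, $u<v$ are separated if $[x,y]\cap[u,v]=\emptyset$; nested if one of the intervals $[x,y],[u,v]$ contains the other; crossing otherwise. A $k$-matching is a set of $k$ pairwise vertex-disjoint edges. A matching is crossing if every pair of its edges crosses, and non-nested if no pair of its edges is nested. $\neg\text{Nest-}\mathcal M_k$ denotes the family of non-nested $k$-matchings. A $k$-matching is strongly non-nested if it is a disjoint union of crossing matchings such that two of its edges cross if and only if they belong to the same one of these crossing matchings (so edges from different parts are separated); $\neg\text{Nest*-}\mathcal M_k$ denotes the family of strongly non-nested $k$-matchings. *)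

theory Defs
  imports Main "HOL-Library.Disjoint_Sets"
begin

text \<open>
  An ordered graph is a pair \<open>(n, E)\<close> with vertex set \<open>{1..n}\<close>. An undirected edge \<open>xy\<close> with
  \<open>x < y\<close> is represented by the pair \<open>(x, y)\<close>.
\<close>

type_synonym edge = "nat \<times> nat"
type_synonym ograph = "nat \<times> edge set"

definition ordered_graph :: "ograph \<Rightarrow> bool" where
  "ordered_graph G \<longleftrightarrow> snd G \<subseteq> {(x, y). 1 \<le> x \<and> x < y \<and> y \<le> fst G}"

definition contains_copy :: "ograph \<Rightarrow> ograph \<Rightarrow> bool" where
  "contains_copy G H \<longleftrightarrow>
     (\<exists>f. strict_mono_on {1..fst H} f \<and> f ` {1..fst H} \<subseteq> {1..fst G} \<and>
          (\<forall>(x, y) \<in> snd H. (f x, f y) \<in> snd G))"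

text \<open>
  The maximum is over a finite set; it is meaningful only if some ordered graph on \<open>{1..n}\<close>
  avoids the family, e.g. if every member of the family has an edge.
\<close>

definition ex_ord :: "nat \<Rightarrow> ograph set \<Rightarrow> nat" where
  "ex_ord n \<H> = Max {card E |E. ordered_graph (n, E) \<and> (\<forall>H \<in> \<H>. \<not> contains_copy (n, E) H)}"

definition edge_verts :: "edge \<Rightarrow> nat set" where
  "edge_verts e = {fst e, snd e}"

definition edge_span :: "edge \<Rightarrow> nat set" where
  "edge_span e = {fst e..snd e}"

definition vertex_disjoint :: "edge \<Rightarrow> edge \<Rightarrow> bool" where
  "vertex_disjoint e f \<longleftrightarrow> edge_verts e \<inter> edge_verts f = {}"

definition separated :: "edge \<Rightarrow> edge \<Rightarrow> bool" where
  "separated e f \<longleftrightarrow> vertex_disjoint e f \<and> edge_span e \<inter> edge_span f = {}"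

definition nested :: "edge \<Rightarrow> edge \<Rightarrow> bool" where
  "nested e f \<longleftrightarrow> vertex_disjoint e f \<and> (edge_span e \<subseteq> edge_span f \<or> edge_span f \<subseteq> edge_span e)"

definition crossing :: "edge \<Rightarrow> edge \<Rightarrow> bool" where
  "crossing e f \<longleftrightarrow> vertex_disjoint e f \<and> \<not> separated e f \<and> \<not> nested e f"

definition matching :: "edge set \<Rightarrow> bool" where
  "matching M \<longleftrightarrow> finite M \<and> (\<forall>(x, y) \<in> M. x < y) \<and> pairwise vertex_disjoint M"

definition crossing_matching :: "edge set \<Rightarrow> bool" where
  "crossing_matching M \<longleftrightarrow> matching M \<and> pairwise crossing M"

definition non_nested_matching :: "edge set \<Rightarrow> bool" where
  "non_nested_matching M \<longleftrightarrow> matching M \<and> pairwise (\<lambda>e f. \<not> nested e f) M"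

text \<open>
  The third conjunct alone would still allow edges of different parts to be nested, which
  the notion is meant to exclude; hence the last conjunct.
\<close>

definition strongly_non_nested_matching :: "edge set \<Rightarrow> bool" where
  "strongly_non_nested_matching M \<longleftrightarrow> matching M \<and>
     (\<exists>P. partition_on M P \<and> (\<forall>C \<in> P. crossing_matching C) \<and>
          pairwise (\<lambda>e f. crossing e f \<longleftrightarrow> (\<exists>C \<in> P. e \<in> C \<and> f \<in> C)) M \<and>
          (\<forall>C \<in> P. \<forall>D \<in> P. C \<noteq> D \<longrightarrow> (\<forall>e \<in> C. \<forall>f \<in> D. separated e f)))"

text \<open>
  As an ordered graph, a \<open>k\<close>-matching has no isolated vertices, so its vertex set is \<open>{1..2 * k}\<close>.
\<close>

definition non_nested_family :: "nat \<Rightarrow> ograph set" where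
  "non_nested_family k =
     {(2 * k, M) |M. ordered_graph (2 * k, M) \<and> card M = k \<and> non_nested_matching M}"

definition strongly_non_nested_family :: "nat \<Rightarrow> ograph set" where
  "strongly_non_nested_family k =
     {(2 * k, M) |M. ordered_graph (2 * k, M) \<and> card M = k \<and> strongly_non_nested_matching M}"

end

theory Submission
  imports Defs "HOL-Library.Multiset"
begin

text \<open>
  The lower bound is attained by joining \<open>k - 1\<close> initial vertices to everything and adding a clique
  on the next \<open>k\<close> vertices.

  For the upper bound let \<open>s = k - 1\<close> and draw the graph as cells \<open>(x, y)\<close>, \<open>x < y\<close>, of a
  triangle. A wire enters each row \<open>y\<close> from the left, turns at the diagonal and leaves at the top of
  a column. At every cell two wires meet; they cross if the cell is a non-edge and they have not crossed
  before, and they bounce off each other otherwise. If \<open>u\<close> lists the wires leaving through the columns,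
  the number of edges is at most the number of inversions of \<open>u\<close>, which is the sum over the columns
  of the number of smaller wires further to the right (the code of the column). Counting the wires above
  a threshold that leave through an initial set of columns computes longest chains of edges, increasing in
  both coordinates. Chains through a common cut are crossing matchings, so they have at most
  \<open>s\<close> edges, and an arbitrary chain is a union of two strongly non-nested matchings, so it has at most
  \<open>2 s\<close> edges. The first fact bounds the codes of all columns after the first \<open>s\<close> by \<open>s\<close>, after the
  corner cells with \<open>y - x \<ge> n - s\<close> have been added as edges; the second bounds the number of
  nonzero codes by \<open>2 s\<close>. Hence there are at most
  \<open>(n - 1) + \<dots> + (n - s) + s\<^sup>2 = s n + s (s - 1) / 2\<close> inversions.
\<close>

section \<open>Wirings and longest chains\<close>

definition strict_chain :: "edge set \<Rightarrow> bool" where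
  "strict_chain C \<longleftrightarrow>
     pairwise (\<lambda>e f. fst e < fst f \<and> snd e < snd f \<or> fst f < fst e \<and> snd f < snd e) C"

text \<open>
  One row of the wiring: \<open>h\<close> is the wire travelling along the row, the list holds the wires coming up
  the columns, and \<open>e k\<close> says that column \<open>k\<close> (counted from 0) has an edge in this row. Wires are
  named by the row they enter, and two of them have already crossed iff the larger one is the one coming
  up the column. The wire left over at the diagonal is appended.
\<close>

fun bubble :: "(nat \<Rightarrow> bool) \<Rightarrow> nat \<Rightarrow> nat list \<Rightarrow> nat list" where
  "bubble e h [] = [h]"
| "bubble e h (j # js) =
     (if e 0 \<or> h \<le> j then h # bubble (\<lambda>k. e (Suc k)) j js else j # bubble (\<lambda>k. e (Suc k)) h js)"

text \<open>
  With \<open>d = False\<close> the wires do not turn at the diagonal: they end there, and the dummy wire 0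
  starts in the new column. Then all chains are counted, whereas \<open>d = True\<close> also counts diagonal
  cells as members of chains.
\<close>

fun wires :: "bool \<Rightarrow> edge set \<Rightarrow> nat \<Rightarrow> nat list" where
  "wires d F 0 = []"
| "wires d F (Suc m) =
     (let r = bubble (\<lambda>k. (Suc k, Suc m) \<in> F) (Suc m) (wires d F m)
      in if d then r else butlast r @ [0])"

fun invs :: "nat list \<Rightarrow> nat" where
  "invs [] = 0"
| "invs (a # l) = length (filter (\<lambda>b. b < a) l) + invs l"

definition count_above :: "nat \<Rightarrow> nat \<Rightarrow> nat list \<Rightarrow> nat" where
  "count_above p q l = length (filter (\<lambda>v. p < v) (take q l))"

section \<open>Basic invariants of a row and of the wirings\<close>

lemma mset_bubble: "mset (bubble e h l) = add_mset h (mset l)"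
  by (induction l arbitrary: e h) auto

lemma set_bubble: "set (bubble e h l) = insert h (set l)"
  using mset_bubble[of e h l] by (metis set_mset_add_mset_insert set_mset_mset)

lemma length_bubble [simp]: "length (bubble e h l) = Suc (length l)"
  using mset_bubble[of e h l] by (metis mset.simps(2) length_Cons size_mset)

lemma length_filter_bubble: "length (filter Q (bubble e h l)) = length (filter Q (h # l))"
  using mset_bubble[of e h l] by (metis mset.simps(2) mset_filter size_mset)

lemma length_wires [simp]: "length (wires d F m) = m"
  by (induction m) (auto simp: Let_def)

lemma wires_le: "v \<in> set (wires d F m) \<Longrightarrow> v \<le> m"
proof (induction m arbitrary: v)
  case (Suc m)
  let ?r = "bubble (\<lambda>k. (Suc k, Suc m) \<in> F) (Suc m) (wires d F m)"
  have "v \<in> set ?r \<or> v = 0"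
    using Suc.prems by (auto simp: Let_def split: if_splits dest: in_set_butlastD)
  then show ?case
    using Suc.IH[of v] by (auto simp: set_bubble)
qed auto

lemma mset_wires: "mset (wires True F m) = mset [1..<Suc m]"
  by (induction m) (auto simp: Let_def mset_bubble)

section \<open>Edges counted by inversions\<close>

text \<open>Each step either keeps the order of \<open>h\<close> and \<open>j\<close> or puts the
  smaller \<open>j\<close> in front. The latter destroys exactly one inversion and happens only at a
  non-edge.\<close>

lemma invs_bubble:
  "invs (h # l) \<le> invs (bubble e h l) + card {k. k < length l \<and> \<not> e k}"
proof (induction l arbitrary: e h)
  case (Cons j js)
  let ?e = "\<lambda>k. e (Suc k)"
  let ?S = "{k. k < length js \<and> \<not> ?e k}"
  have "Suc ` ?S \<subseteq> {k. k < length (j # js) \<and> \<not> e k}"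
    by auto
  then have c: "card ?S \<le> card {k. k < length (j # js) \<and> \<not> e k}"
    using card_mono[of "{k. k < length (j # js) \<and> \<not> e k}" "Suc ` ?S"] by (simp add: card_image)
  have c0: "card {k. k < length (j # js) \<and> \<not> e k} = Suc (card ?S)" if "\<not> e 0"
  proof -
    have "{k. k < length (j # js) \<and> \<not> e k} = insert 0 (Suc ` ?S)"
      using that by (auto simp: image_iff less_Suc_eq_0_disj)
    then show ?thesis
      by (simp add: card_image)
  qed
  show ?case
  proof (cases "e 0 \<or> h \<le> j")
    case True
    then show ?thesis
      using Cons.IH[of j ?e] c by (auto simp: length_filter_bubble)
  next
    case False
    then show ?thesis
      using Cons.IH[of h ?e] c0 by (auto simp: length_filter_bubble)
  qed
qed auto

text \<open>The wire entering row \<open>Suc m\<close> exceeds the \<open>m\<close> wires present,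
  so placing it in front creates \<open>m\<close> inversions. The row then loses at most one for
  each non-edge among its \<open>m\<close> cells, which leaves at least one for each edge.\<close>

lemma card_le_invs_wires:
  assumes "\<And>x y. (x, y) \<in> F \<Longrightarrow> 1 \<le> x \<and> x < y"
  shows "card {e \<in> F. snd e \<le> m} \<le> invs (wires True F m)"
proof (induction m)
  case 0
  have "{e \<in> F. snd e \<le> 0} = {}"
    using assms by force
  then show ?case by (metis card.empty zero_le)
next
  case (Suc m)
  let ?u = "wires True F m" and ?e = "\<lambda>k. (Suc k, Suc m) \<in> F"
  let ?K = "{k. k < m \<and> ?e k}"
  have "{e \<in> F. snd e \<le> Suc m} \<subseteq> {e \<in> F. snd e \<le> m} \<union> (\<lambda>k. (Suc k, Suc m)) ` ?K"
  proof
    fix e assume "e \<in> {e \<in> F. snd e \<le> Suc m}"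
    then show "e \<in> {e \<in> F. snd e \<le> m} \<union> (\<lambda>k. (Suc k, Suc m)) ` ?K"
      using assms[of "fst e" "snd e"]
      by (cases e; cases "fst e") (auto simp: image_iff le_Suc_eq)
  qed
  moreover have fin: "finite {e \<in> F. snd e \<le> m}"
    by (rule finite_subset[of _ "{..m} \<times> {..m}"]) (use assms in force)+
  ultimately have "card {e \<in> F. snd e \<le> Suc m} \<le> card ({e \<in> F. snd e \<le> m} \<union> (\<lambda>k. (Suc k, Suc m)) ` ?K)"
    by (intro card_mono) auto
  also have "\<dots> \<le> card {e \<in> F. snd e \<le> m} + card ?K"
    by (rule order.trans[OF card_Un_le]) (simp add: card_image_le)
  finally have 1: "card {e \<in> F. snd e \<le> Suc m} \<le> invs ?u + card ?K"
    using Suc.IH by simp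
  have "filter (\<lambda>b. b < Suc m) ?u = ?u"
    using wires_le[of _ True F m] by (intro filter_True) (auto simp: less_Suc_eq_le)
  then have "m + invs ?u = invs (Suc m # ?u)"
    by simp
  also have "\<dots> \<le> invs (bubble ?e (Suc m) ?u) + card {k. k < m \<and> \<not> ?e k}"
    using invs_bubble[of "Suc m" ?u ?e] by simp
  finally have 2: "m + invs ?u \<le> invs (bubble ?e (Suc m) ?u) + card {k. k < m \<and> \<not> ?e k}" .
  have "card ?K + card {k. k < m \<and> \<not> ?e k} = card (?K \<union> {k. k < m \<and> \<not> ?e k})"
    by (intro card_Un_disjoint[symmetric]) auto
  also have "?K \<union> {k. k < m \<and> \<not> ?e k} = {..<m}"
    by auto
  finally show ?case
    using 1 2 by (simp add: Let_def)
qed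

text \<open>
  This relation between the two wirings survives every row because it is preserved when two adjacent
  entries are sorted simultaneously in both lists. It shows that a column with nonzero code carries a
  nonzero wire when \<open>d = False\<close>.
\<close>

fun dominates :: "nat list \<Rightarrow> nat list \<Rightarrow> bool" where
  "dominates [] [] = True"
| "dominates (a # U) (b # W) = (b \<le> a \<and> (\<forall>v \<in> set U. v < a \<longrightarrow> v < b) \<and> dominates U W)"
| "dominates _ _ = False"

lemma dominates_bubble:
  "dominates (h # U) (h' # W) \<Longrightarrow> dominates (bubble e h U) (bubble e h' W)"
proof (induction U arbitrary: e h h' W)
  case Nil
  then show ?case by (cases W) auto
next
  case (Cons j U)
  then obtain j' W' where W: "W = j' # W'"
    by (cases W) auto
  show ?case
  proof (cases "e 0")
    case True
    then show ?thesis
      using Cons.prems Cons.IH[of j j' W'] by (auto simp: W set_bubble)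
  next
    case False
    \<comment> \<open>At a non-edge the smaller wire leaves and the larger one travels on, so both
      lists undergo the same sorting step even where their comparisons come out differently.\<close>
    have b: "bubble e a (b # l) = min a b # bubble (\<lambda>k. e (Suc k)) (max a b) l" for a b l
      using False by (auto simp: min_def max_def)
    have "dominates (max h j # U) (max h' j' # W')"
      using Cons.prems by (auto simp: W max_def)
    from Cons.IH[OF this] show ?thesis
      using Cons.prems unfolding W b by (auto simp: set_bubble min_def max_def)
  qed
qed

text \<open>An entry of \<open>W\<close> is bounded from below only by entries of \<open>U\<close>
  further right. The last one has none, so the dummy wire 0 fits there.\<close>

lemma dominates_butlast_snoc:
  "dominates U W \<Longrightarrow> U \<noteq> [] \<Longrightarrow> dominates U (butlast W @ [0])"
proof (induction U W rule: dominates.induct)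
  case (2 a U b W)
  then show ?case
    by (cases U; cases W) simp_all
qed simp_all

lemma dominates_wires: "dominates (wires True F m) (wires False F m)"
proof (induction m)
  case (Suc m)
  let ?e = "\<lambda>k. (Suc k, Suc m) \<in> F"
  have "dominates (Suc m # wires True F m) (Suc m # wires False F m)"
    using Suc.IH wires_le[of _ True F m] by auto
  from dominates_bubble[OF this, of ?e]
  have "dominates (bubble ?e (Suc m) (wires True F m)) (bubble ?e (Suc m) (wires False F m))" .
  moreover have "bubble ?e (Suc m) (wires True F m) \<noteq> []"
    using length_bubble[of ?e "Suc m" "wires True F m"] by force
  ultimately show ?case
    using dominates_butlast_snoc by (simp add: Let_def)
qed auto

lemma dominates_nth:
  "dominates U W \<Longrightarrow> i < j \<Longrightarrow> j < length U \<Longrightarrow> U ! j < U ! i \<Longrightarrow> U ! j < W ! i"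
proof (induction U W arbitrary: i j rule: dominates.induct)
  case (2 a U b W)
  then show ?case
    by (cases i; cases j) auto
qed auto

section \<open>Chains counted by wires above a threshold\<close>

text \<open>Call a wire large if it exceeds \<open>p\<close>. After a large start, the old and new
  counts agree while a large wire travels, and the new one is higher by one while a small wire does.
  The travelling wire turns from large to small only by bouncing off a small wire at an edge, and
  back at the next large one. So if it is small at column \<open>q\<close>, no large wire came up
  after the last such bounce, at column \<open>k\<close>, and the new count is one more than the old
  count left of \<open>k\<close>. A small start keeps the new count at 0 up to the first large wire
  and lowers it by one afterwards; the induction needs this case after a bounce.\<close>

lemma count_above_bubble:
  "(p < h \<longrightarrow> count_above p q (bubble e h l) \<le> count_above p q l \<or>
      (\<exists>k<q. e k \<and> count_above p q (bubble e h l) \<le> Suc (count_above p k l))) \<and>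
   (h \<le> p \<longrightarrow> count_above p q (bubble e h l) = 0 \<or> Suc (count_above p q (bubble e h l)) \<le> count_above p q l \<or>
      (\<exists>k<q. e k \<and> count_above p q (bubble e h l) \<le> count_above p k l))"
  if "q \<le> length l"
  using that
proof (induction l arbitrary: e h q)
  case Nil
  then show ?case by (simp add: count_above_def)
next
  case (Cons j js)
  show ?case
  proof (cases q)
    case 0
    then show ?thesis by (simp add: count_above_def)
  next
    case (Suc r)
    let ?e = "\<lambda>k. e (Suc k)"
    have r: "r \<le> length js"
      using Cons.prems Suc by simp
    have ab: "count_above p (Suc k) (a # l) = (if p < a then 1 else 0) + count_above p k l" for k a l
      by (simp add: count_above_def)
    have ex0: "\<exists>k<Suc r. e k \<and> c \<le> Suc (count_above p k (j # js))" if "e 0" "c \<le> 1" for c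
      using that by (intro exI[of _ 0]) auto
    have exS: "\<exists>k<Suc r. e k \<and> c + (if p < j then 1 else 0) \<le> d + count_above p k (j # js)"
      if *: "\<exists>k<r. ?e k \<and> c \<le> d + count_above p k js" for c d
    proof -
      obtain k where "k < r" "?e k" "c \<le> d + count_above p k js"
        using * by blast
      then show ?thesis
        by (intro exI[of _ "Suc k"]) (simp add: ab)
    qed
    show ?thesis
    proof (cases "e 0 \<or> h \<le> j")
      case swap: True
      then have bub: "bubble e h (j # js) = h # bubble ?e j js"
        by simp
      let ?c = "count_above p r (bubble ?e j js)"
      note IH = Cons.IH[OF r, of j ?e]
      show ?thesis
      proof (cases "p < j")
        case True
        then consider "?c \<le> count_above p r js" | "\<exists>k<r. ?e k \<and> ?c \<le> 1 + count_above p k js"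
          using IH by auto
        then show ?thesis
        proof cases
          case 1
          then show ?thesis
            using True by (simp add: Suc bub ab del: bubble.simps)
        next
          case 2
          from exS[OF this] show ?thesis
            using True by (cases "p < h") (auto simp: Suc bub ab simp del: bubble.simps)
        qed
      next
        case False
        then consider "?c = 0" | "Suc ?c \<le> count_above p r js" | "\<exists>k<r. ?e k \<and> ?c \<le> 0 + count_above p k js"
          using IH by auto
        then show ?thesis
        proof cases
          case 1
          then show ?thesis
            using False ex0[of 1] swap by (cases "p < h") (simp_all add: Suc bub ab del: bubble.simps)
        next
          case 2
          then show ?thesis
            using False by (simp add: Suc bub ab del: bubble.simps)
        next
          case 3
          from exS[OF this] show ?thesis
            using False by (simp add: Suc bub ab del: bubble.simps)
        qed
      qed
    next
      case pass: False
      then have bub: "bubble e h (j # js) = j # bubble ?e h js"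
        by simp
      let ?c = "count_above p r (bubble ?e h js)"
      note IH = Cons.IH[OF r, of h ?e]
      show ?thesis
      proof (cases "p < h")
        case True
        then consider "?c \<le> count_above p r js" | "\<exists>k<r. ?e k \<and> ?c \<le> 1 + count_above p k js"
          using IH by auto
        then show ?thesis
        proof cases
          case 1
          then show ?thesis
            using True by (simp add: Suc bub ab del: bubble.simps)
        next
          case 2
          from exS[OF this] show ?thesis
            using True by (simp add: Suc bub ab add.commute del: bubble.simps)
        qed
      next
        case False
        then have j: "\<not> p < j"
          using pass by simp
        from False consider "?c = 0" | "Suc ?c \<le> count_above p r js" | "\<exists>k<r. ?e k \<and> ?c \<le> 0 + count_above p k js"
          using IH by auto
        then show ?thesis
        proof cases
          case 3
          from exS[OF this] show ?thesis
            using False j by (simp add: Suc bub ab del: bubble.simps)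
        qed (use False j in \<open>simp_all add: Suc bub ab del: bubble.simps\<close>)
      qed
    qed
  qed
qed

lemma count_above_eq_card: "count_above p q l = card {i. i < q \<and> i < length l \<and> p < l ! i}"
proof -
  have "count_above p q l = card {i. i < length (take q l) \<and> p < take q l ! i}"
    unfolding count_above_def by (rule length_filter_conv_card)
  also have "{i. i < length (take q l) \<and> p < take q l ! i} = {i. i < q \<and> i < length l \<and> p < l ! i}"
    by auto
  finally show ?thesis .
qed

lemma strict_chain_subset: "strict_chain C \<Longrightarrow> D \<subseteq> C \<Longrightarrow> strict_chain D"
  unfolding strict_chain_def by (rule pairwise_subset)

text \<open>\<open>count_above_bubble\<close> is the recursion for longest chains: the new row is
  either skipped, or its edge in column \<open>Suc k\<close> extends a chain in the first
  \<open>k\<close> columns. With turns at the diagonal \<open>q \<le> p\<close> is assumed, so that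
  the columns up to \<open>q\<close> meet the rows after \<open>p\<close> strictly off the
  diagonal.\<close>

lemma chain_wires:
  assumes "\<not> d \<or> q \<le> p"
  shows "\<exists>C\<subseteq>F. finite C \<and> strict_chain C
    \<and> (\<forall>e\<in>C. fst e \<le> q \<and> p < snd e \<and> snd e \<le> m) \<and> count_above p q (wires d F m) \<le> card C"
  using assms
proof (induction m arbitrary: q)
  case 0
  then show ?case
    by (intro exI[of _ "{}"]) (simp add: count_above_def strict_chain_def)
next
  case (Suc m)
  show ?case
  proof (cases "Suc m \<le> p")
    case True
    have "filter (\<lambda>v. p < v) (take q (wires d F (Suc m))) = []"
      using wires_le[of _ d F "Suc m"] True
      by (auto simp: filter_empty_conv simp del: wires.simps dest!: in_set_takeD) fastforce
    then show ?thesis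
      by (intro exI[of _ "{}"]) (simp add: count_above_def strict_chain_def del: wires.simps)
  next
    case False
    let ?l = "wires d F m" and ?e = "\<lambda>k. (Suc k, Suc m) \<in> F"
    let ?r = "bubble ?e (Suc m) ?l"
    \<comment> \<open>Row \<open>Suc m\<close> has \<open>m\<close> cells, and the entry after them
      belongs to the diagonal. It is either beyond \<open>q\<close>, because
      \<open>q \<le> p < Suc m\<close>, or the dummy 0, which never exceeds
      \<open>p\<close>.\<close>
    define q' where "q' = min q m"
    have "count_above p q (wires d F (Suc m)) = count_above p q' ?r"
    proof (cases d)
      case True
      then show ?thesis
        using Suc.prems False by (simp add: q'_def Let_def min_def)
    next
      case nd: False
      have "butlast ?r = take m ?r"
        by (simp add: butlast_conv_take)
      then have "filter (\<lambda>v. p < v) (take q (butlast ?r @ [0])) = filter (\<lambda>v. p < v) (take q' ?r)"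
        by (cases "q \<le> m") (simp_all add: q'_def min_def)
      then show ?thesis
        using nd by (simp add: count_above_def Let_def)
    qed
    moreover have "count_above p q' ?r \<le> count_above p q' ?l \<or> (\<exists>k<q'. ?e k \<and> count_above p q' ?r \<le> Suc (count_above p k ?l))"
      using count_above_bubble[of q' ?l p "Suc m" ?e] False by (simp add: q'_def)
    ultimately consider "count_above p q (wires d F (Suc m)) \<le> count_above p q' ?l"
      | k where "k < q'" "?e k" "count_above p q (wires d F (Suc m)) \<le> Suc (count_above p k ?l)"
      by auto
    then show ?thesis
    proof cases
      case 1
      have "\<not> d \<or> q' \<le> p"
        using Suc.prems by (auto simp: q'_def)
      from Suc.IH[OF this] obtain C where "C \<subseteq> F" "finite C" "strict_chain C"
        "\<forall>e\<in>C. fst e \<le> q' \<and> p < snd e \<and> snd e \<le> m" "count_above p q' ?l \<le> card C"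
        by blast
      then show ?thesis
        using 1 by (intro exI[of _ C]) (auto simp: q'_def simp del: wires.simps)
    next
      case (2 k)
      have "\<not> d \<or> k \<le> p"
        using Suc.prems 2(1) by (auto simp: q'_def)
      from Suc.IH[OF this] obtain C where C: "C \<subseteq> F" "finite C" "strict_chain C"
        "\<forall>e\<in>C. fst e \<le> k \<and> p < snd e \<and> snd e \<le> m" "count_above p k ?l \<le> card C"
        by blast
      let ?C = "insert (Suc k, Suc m) C"
      have "(Suc k, Suc m) \<notin> C"
        using C(4) by auto
      then have "card ?C = Suc (card C)"
        using C(2) by simp
      moreover have "strict_chain ?C"
        using C(3,4) unfolding strict_chain_def pairwise_insert by (auto simp: less_Suc_eq_le)
      ultimately show ?thesis
        using 2 C False by (intro exI[of _ ?C]) (auto simp: q'_def simp del: wires.simps)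
    qed
  qed
qed

section \<open>The first columns and the bound on inversions\<close>

lemma take_bubble:
  "\<forall>k<j. e k \<Longrightarrow> j \<le> length l \<Longrightarrow> take j (bubble e h l) = take j (h # l)"
proof (induction l arbitrary: e h j)
  case (Cons a l)
  show ?case
  proof (cases j)
    case (Suc i)
    then show ?thesis
      using Cons.prems Cons.IH[of i "\<lambda>k. e (Suc k)" a] by auto
  qed simp
qed simp

text \<open>Row \<open>n - s + j\<close> has edges in its first \<open>j\<close> columns, so its
  wire bounces up into column 1 and the wires in front shift right by one.
  \<open>2 * s \<le> n\<close> keeps these cells left of the diagonal.\<close>

lemma take_wires:
  assumes "\<And>x y. 1 \<le> x \<Longrightarrow> x + (n - s) \<le> y \<Longrightarrow> y \<le> n \<Longrightarrow> (x, y) \<in> F" "2 * s \<le> n" "j \<le> s"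
  shows "take j (wires True F (n - s + j)) = rev [n - s + 1..<n - s + j + 1]"
  using assms(3)
proof (induction j)
  case (Suc j)
  let ?m = "n - s + j"
  have "\<forall>k<Suc j. (Suc k, Suc ?m) \<in> F"
    using Suc.prems assms(2) by (intro allI impI assms(1)) auto
  moreover have "Suc j \<le> length (wires True F ?m)"
    using Suc.prems assms(2) by simp
  ultimately have "take (Suc j) (wires True F (Suc ?m)) = take (Suc j) (Suc ?m # wires True F ?m)"
    using take_bubble[of "Suc j" "\<lambda>k. (Suc k, Suc ?m) \<in> F" "wires True F ?m" "Suc ?m"]
    by (simp add: Let_def)
  then show ?case
    using Suc by simp
qed simp

lemma invs_eq_sum:
  "invs l = (\<Sum>i<length l. card {j. i < j \<and> j < length l \<and> l ! j < l ! i})"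
proof (induction l)
  case (Cons a l)
  have *: "{j. i < j \<and> j < length (a # l) \<and> (a # l) ! j < (a # l) ! i}
    = Suc ` {j. i < Suc j \<and> j < length l \<and> l ! j < (a # l) ! i}" for i
  proof -
    have "x \<in> Suc ` {j. i < Suc j \<and> j < length l \<and> l ! j < (a # l) ! i}"
      if "i < x" "x < length (a # l)" "(a # l) ! x < (a # l) ! i" for x
      using that by (cases x) auto
    then show ?thesis
      by auto
  qed
  have "length (filter (\<lambda>b. b < a) l) = card {j. j < length l \<and> l ! j < a}"
    by (rule length_filter_conv_card)
  then show ?case
    using Cons.IH unfolding * by (simp add: card_image sum.lessThan_Suc_shift del: sum.lessThan_Suc)
qed simp

lemma sum_lessThan_nat_eq_choose: "(\<Sum>i<s. i) = s choose 2"
  by (induction s) (simp_all add: numeral_2_eq_2)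

lemma two_times_choose_two: "2 * (s choose 2) = s * (s - 1)" for s :: nat
  by (induction s) (auto simp: numeral_2_eq_2 algebra_simps)

lemma invs_wires_le:
  assumes top: "\<And>x y. 1 \<le> x \<Longrightarrow> x + (n - s) \<le> y \<Longrightarrow> y \<le> n \<Longrightarrow> (x, y) \<in> F"
    and n: "2 * s \<le> n"
    and cross: "\<And>C p. C \<subseteq> F \<Longrightarrow> finite C \<Longrightarrow> strict_chain C
      \<Longrightarrow> (\<And>x y. (x, y) \<in> C \<Longrightarrow> x \<le> p \<and> p < y) \<Longrightarrow> card C \<le> s"
    and chain: "\<And>C. C \<subseteq> F \<Longrightarrow> finite C \<Longrightarrow> strict_chain C \<Longrightarrow> card C \<le> 2 * s"
  shows "invs (wires True F n) \<le> s * n + (s choose 2)"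
proof -
  define u where "u = wires True F n"
  define w where "w = wires False F n"
  define code where "code i = card {j. i < j \<and> j < n \<and> u ! j < u ! i}" for i
  have len: "length u = n" "length w = n"
    by (simp_all add: u_def w_def)
  have mu: "mset u = mset [1..<Suc n]"
    unfolding u_def by (rule mset_wires)
  have du: "distinct u"
    using mset_eq_imp_distinct_iff[OF mu] distinct_upt by blast
  have su: "set u = {1..n}"
    using mset_eq_setD[OF mu] by auto
  \<comment> \<open>The wires above \<open>p\<close> in the first \<open>p\<close> columns yield a
    chain of at least as many edges with left ends at most \<open>p\<close> and right ends beyond
    it, so \<open>cross\<close> applies.\<close>
  have diag: "card {i. i < p \<and> i < n \<and> p < u ! i} \<le> s" for p
  proof -
    obtain C where "C \<subseteq> F" "finite C" "strict_chain C"
      "\<forall>e\<in>C. fst e \<le> p \<and> p < snd e \<and> snd e \<le> n" "count_above p p u \<le> card C"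
      using chain_wires[of True p p F n] unfolding u_def by auto
    moreover from this have "card C \<le> s"
      by (intro cross) auto
    ultimately show ?thesis
      by (simp add: count_above_eq_card len)
  qed
  have "take s u = rev [n - s + 1..<n + 1]"
    using take_wires[of n s F s] top n unfolding u_def by simp
  then have ts: "set (take s u) = {n - s + 1..n}"
    by auto
  have first: "u ! i \<in> {n - s + 1..n} \<longleftrightarrow> i < s" if "i < n" for i
  proof
    assume "u ! i \<in> {n - s + 1..n}"
    then have "u ! i \<in> set (take s u)"
      by (simp only: ts)
    then obtain j where "j < length (take s u)" "take s u ! j = u ! i"
      unfolding in_set_conv_nth by blast
    then have "j < s" "j < n" "u ! j = u ! i"
      using len by auto
    then show "i < s"
      using nth_eq_iff_index_eq[OF du, of j i] that len by simp
  next
    assume "i < s"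
    then have "take s u ! i \<in> set (take s u)"
      using that len by (intro nth_mem) simp
    then show "u ! i \<in> {n - s + 1..n}"
      using \<open>i < s\<close> by (simp only: ts nth_take)
  qed
  \<comment> \<open>If \<open>Suc i \<le> n - s\<close>, a larger \<open>u ! i\<close> together with
    the \<open>s\<close> largest wires in front would give \<open>s + 1\<close> wires above
    \<open>Suc i\<close> in the first \<open>Suc i\<close> columns, against \<open>diag\<close>.
    Otherwise \<open>u ! i\<close> is not among the \<open>s\<close> largest, so it is at most
    \<open>n - s \<le> i\<close>.\<close>
  have small: "u ! i \<le> Suc i" if i: "s \<le> i" "i < n" for i
  proof (cases "Suc i \<le> n - s")
    case True
    show ?thesis
    proof (rule ccontr)
      assume "\<not> u ! i \<le> Suc i"
      moreover have "Suc i < u ! j" if "j < s" for j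
        using first[of j] that i True by simp
      ultimately have "insert i {..<s} \<subseteq> {j. j < Suc i \<and> j < n \<and> Suc i < u ! j}"
        using i by auto
      then have "card (insert i {..<s}) \<le> card {j. j < Suc i \<and> j < n \<and> Suc i < u ! j}"
        by (intro card_mono) auto
      also have "\<dots> \<le> s"
        by (rule diag)
      finally show False
        using i by simp
    qed
  next
    case False
    have "u ! i \<notin> {n - s + 1..n}"
      using first[OF i(2)] i(1) by simp
    moreover have "u ! i \<in> {1..n}"
      using nth_mem[of i u] su len i by simp
    ultimately show ?thesis
      using False by simp
  qed
  have code_s: "code i \<le> s" if i: "s \<le> i" "i < n" for i
  proof -
    have ui: "1 \<le> u ! i"
      using nth_mem[of i u] su len i by simp
    define p where "p = u ! i - 1"
    have p: "p \<le> i" "p < n"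
      using small[OF i] i by (auto simp: p_def)
    let ?A = "{j. j < n \<and> u ! j \<le> p}"
    have "(!) u ` ?A = {1..p}"
    proof -
      have "x \<in> (!) u ` ?A" if "1 \<le> x" "x \<le> p" for x
      proof -
        have "x \<in> set u"
          using that p su by auto
        then show ?thesis
          using that by (auto simp: in_set_conv_nth len)
      qed
      moreover have "1 \<le> u ! j" if "j < n" for j
        using nth_mem[of j u] su len that by simp
      ultimately show ?thesis
        by auto
    qed
    moreover have "inj_on ((!) u) ?A"
      using du len by (auto simp: inj_on_def nth_eq_iff_index_eq)
    ultimately have cA: "card ?A = p"
      using card_image[of "(!) u" ?A] by simp
    \<comment> \<open>Since \<open>u\<close> is a permutation, as many wires at most
      \<open>p\<close> lie outside the first \<open>p\<close> columns (\<open>?R\<close>) as wires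
      above \<open>p\<close> lie inside them (\<open>?D\<close>). The wires counted by
      \<open>code i\<close> are among the former because \<open>p \<le> i\<close>.\<close>
    let ?L = "{j. j < p \<and> u ! j \<le> p}" and ?R = "{j. j < n \<and> p \<le> j \<and> u ! j \<le> p}"
      and ?D = "{j. j < p \<and> j < n \<and> p < u ! j}"
    have "card ?A = card ?L + card ?R"
      using p by (subst card_Un_disjoint[symmetric]) (auto intro!: arg_cong[where f = card])
    moreover have "p = card ?L + card ?D"
    proof -
      have "?L \<union> ?D = {..<p}"
        using p by auto
      moreover have "card (?L \<union> ?D) = card ?L + card ?D"
        by (intro card_Un_disjoint) auto
      ultimately show ?thesis
        by simp
    qed
    ultimately have "card ?R = card ?D"
      using cA by simp
    moreover have "code i \<le> card ?R"
      unfolding code_def using p ui by (intro card_mono) (auto simp: p_def)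
    ultimately show ?thesis
      using diag[of p] by simp
  qed
  have code_n: "code i \<le> n - 1 - i" for i
  proof -
    have "code i \<le> card {i<..<n}"
      unfolding code_def by (intro card_mono) auto
    then show ?thesis
      by simp
  qed
  define S where "S = {i. i < n \<and> 0 < code i}"
  have "card S \<le> 2 * s"
  proof -
    \<comment> \<open>By domination, a smaller wire further right forces a positive entry of
      \<open>w\<close> in the same column. Some chain has at least as many edges as \<open>w\<close>
      has positive entries.\<close>
    have "S \<subseteq> {i. i < n \<and> i < length w \<and> 0 < w ! i}"
    proof
      fix i assume "i \<in> S"
      then obtain j where "i < n" "i < j" "j < n" "u ! j < u ! i"
        by (auto simp: S_def code_def card_gt_0_iff)
      then show "i \<in> {i. i < n \<and> i < length w \<and> 0 < w ! i}"
        using dominates_nth[OF dominates_wires[of F n], of i j] len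
        unfolding u_def[symmetric] w_def[symmetric] by auto
    qed
    then have "card S \<le> count_above 0 n w"
      unfolding count_above_eq_card by (intro card_mono) auto
    moreover obtain C where "C \<subseteq> F" "finite C" "strict_chain C" "count_above 0 n w \<le> card C"
      using chain_wires[of False n 0 F n] unfolding w_def by auto
    ultimately show ?thesis
      using chain[of C] by simp
  qed
  \<comment> \<open>The codes are bounded by \<open>n - 1 - i\<close> on \<open>?A\<close> and by
    \<open>s\<close> on \<open>?B\<close>. A column of \<open>?C\<close> leaves its allowance
    \<open>n - 1 - i \<ge> s\<close> unspent, which pays for the one extra column that
    \<open>?B\<close> may then have.\<close>
  let ?A = "S \<inter> {..<s}" and ?B = "S - {..<s}" and ?C = "{..<s} - S"
  have fS: "finite S"
    by (simp add: S_def)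
  have "card S = card ?A + card ?B"
    using fS by (metis card_Int_Diff)
  moreover have "s = card ?A + card ?C"
    using card_Int_Diff[of "{..<s}" S] by (simp add: Int_commute)
  ultimately have cB: "card ?B \<le> s + card ?C"
    using \<open>card S \<le> 2 * s\<close> by simp
  have "invs u = (\<Sum>i<n. code i)"
    unfolding invs_eq_sum code_def len ..
  also have "\<dots> = sum code S"
    by (rule sum.mono_neutral_right) (auto simp: S_def)
  also have "\<dots> = sum code ?A + sum code ?B"
    using fS by (simp add: sum.Int_Diff)
  also have "sum code ?A \<le> (\<Sum>i\<in>?A. n - 1 - i)"
    by (intro sum_mono code_n)
  also have "sum code ?B \<le> card ?B * s"
    using code_s sum_bounded_above[of ?B code s] by (auto simp: S_def)
  also have "card ?B * s \<le> s * s + (\<Sum>i\<in>?C. s)"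
    using mult_le_mono1[OF cB, of s] by (simp add: algebra_simps)
  also have "(\<Sum>i\<in>?C. s) \<le> (\<Sum>i\<in>?C. n - 1 - i)"
    using n by (intro sum_mono) auto
  finally have "invs u \<le> s * s + ((\<Sum>i\<in>?A. n - 1 - i) + (\<Sum>i\<in>?C. n - 1 - i))"
    by simp
  also have "(\<Sum>i\<in>?A. n - 1 - i) + (\<Sum>i\<in>?C. n - 1 - i) = (\<Sum>i<s. n - 1 - i)"
    by (subst Int_commute) (simp add: sum.Int_Diff[of "{..<s}" _ S])
  finally have le: "invs u \<le> s * s + (\<Sum>i<s. n - 1 - i)" .
  have "(\<Sum>i<s. n - 1 - i) + (\<Sum>i<s. i) = (\<Sum>i<s. n - 1)"
    unfolding sum.distrib[symmetric] using n by (intro sum.cong) auto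
  then have "(\<Sum>i<s. n - 1 - i) + (s choose 2) = s * (n - 1)"
    by (simp add: sum_lessThan_nat_eq_choose)
  moreover have "s * s + s * (n - 1) = s * n + 2 * (s choose 2)"
    using n unfolding two_times_choose_two by (cases s; cases n) (auto simp: algebra_simps)
  ultimately have "invs u \<le> s * n + (s choose 2)"
    using le by linarith
  then show ?thesis
    by (simp add: u_def)
qed

section \<open>Adding the corner cells\<close>

text \<open>Members up to \<open>x0\<close> have distinct left ends in \<open>{1..x0}\<close>, and
  the later ones have distinct right ends beyond \<open>y0\<close>. For a corner cell, where
  \<open>x0 + (n - s) \<le> y0\<close>, the bound is at most \<open>s\<close>.\<close>

lemma card_strict_chain_le:
  assumes C: "strict_chain C" "(x0, y0) \<in> C" "\<And>x y. (x, y) \<in> C \<Longrightarrow> 1 \<le> x \<and> y \<le> n"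
  shows "card C \<le> x0 + (n - y0)"
proof -
  let ?A = "{e \<in> C. fst e \<le> x0}" and ?B = "{e \<in> C. x0 < fst e}"
  have cmp: "fst e < fst f \<and> snd e < snd f \<or> fst f < fst e \<and> snd f < snd e"
    if "e \<in> C" "f \<in> C" "e \<noteq> f" for e f
    using C(1) that unfolding strict_chain_def pairwise_def by blast
  have "card ?A \<le> card {1..x0}"
  proof (rule card_inj_on_le)
    show "inj_on fst ?A"
      using cmp by (force simp: inj_on_def)
  qed (use C(3) in auto)
  moreover have "card ?B \<le> card {y0<..n}"
  proof (rule card_inj_on_le)
    show "inj_on snd ?B"
      using cmp by (force simp: inj_on_def)
    show "snd ` ?B \<subseteq> {y0<..n}"
      using C(3) cmp[OF _ C(2)] by force
  qed auto
  moreover have "C = ?A \<union> ?B"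
    by auto
  then have "card C \<le> card ?A + card ?B"
    by (metis card_Un_le)
  ultimately show ?thesis
    by simp
qed

text \<open>Adding the corner cells cannot lower the edge count, and it does not spoil the chain
  bounds: a chain through a corner cell has at most \<open>s\<close> members anyway.\<close>

lemma card_le_of_chain_bounds:
  assumes E: "E \<subseteq> {(x, y). 1 \<le> x \<and> x < y \<and> y \<le> n}" and n: "2 * s \<le> n"
    and cross: "\<And>C p. C \<subseteq> E \<Longrightarrow> strict_chain C
      \<Longrightarrow> (\<And>x y. (x, y) \<in> C \<Longrightarrow> x \<le> p \<and> p < y) \<Longrightarrow> card C \<le> s"
    and chain: "\<And>C. C \<subseteq> E \<Longrightarrow> strict_chain C \<Longrightarrow> card C \<le> 2 * s"
  shows "card E \<le> s * n + (s choose 2)"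
proof (cases "n = 0")
  case True
  then have "E = {}"
    using E by force
  then show ?thesis by simp
next
  case False
  define F where "F = E \<union> {(x, y). 1 \<le> x \<and> x + (n - s) \<le> y \<and> y \<le> n}"
  have ns: "0 < n - s"
    using n False by linarith
  have F: "1 \<le> x \<and> x < y \<and> y \<le> n" if "(x, y) \<in> F" for x y
    using that E ns by (auto simp: F_def)
  have top: "card C \<le> s" if "C \<subseteq> F" "strict_chain C" "\<not> C \<subseteq> E" for C
  proof -
    obtain x0 y0 where xy: "(x0, y0) \<in> C" "x0 + (n - s) \<le> y0" "y0 \<le> n"
      using \<open>C \<subseteq> F\<close> \<open>\<not> C \<subseteq> E\<close> by (auto simp: F_def)
    have "card C \<le> x0 + (n - y0)"
      using card_strict_chain_le[OF that(2) xy(1)] F that(1) by blast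
    then show ?thesis
      using xy n by linarith
  qed
  have "finite F"
    by (rule finite_subset[of _ "{..n} \<times> {..n}"]) (use F in force)+
  then have "card E \<le> card {e \<in> F. snd e \<le> n}"
    using E by (intro card_mono) (auto simp: F_def)
  also have "\<dots> \<le> invs (wires True F n)"
    using F by (intro card_le_invs_wires) blast
  also have "\<dots> \<le> s * n + (s choose 2)"
  proof (rule invs_wires_le[OF _ n])
    show "(x, y) \<in> F" if "1 \<le> x" "x + (n - s) \<le> y" "y \<le> n" for x y
      using that by (simp add: F_def)
    show "card C \<le> s"
      if "C \<subseteq> F" "strict_chain C" "\<And>x y. (x, y) \<in> C \<Longrightarrow> x \<le> p \<and> p < y" for C p
      using top[OF that(1,2)] cross[OF _ that(2,3)] by (cases "C \<subseteq> E") simp_all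
    show "card C \<le> 2 * s" if "C \<subseteq> F" "strict_chain C" for C
      using top[OF that] chain[OF _ that(2)] by (cases "C \<subseteq> E") simp_all
  qed
  finally show ?thesis .
qed

section \<open>Strongly non-nested matchings\<close>

lemma separated_iff:
  assumes "x < y" "x' < y'"
  shows "separated (x, y) (x', y') \<longleftrightarrow> y < x' \<or> y' < x"
proof -
  have "edge_span (x, y) \<inter> edge_span (x', y') = {} \<longleftrightarrow> y < x' \<or> y' < x"
    using assms by (auto simp: edge_span_def disjoint_iff not_less)
  then show ?thesis
    using assms by (auto simp: separated_def vertex_disjoint_def edge_verts_def)
qed

lemma nested_iff:
  assumes "x < y" "x' < y'"
  shows "nested (x, y) (x', y') \<longleftrightarrow> x < x' \<and> y' < y \<or> x' < x \<and> y < y'"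
  using assms by (auto simp: nested_def vertex_disjoint_def edge_verts_def edge_span_def)

lemma crossing_iff:
  assumes "x < y" "x' < y'"
  shows "crossing (x, y) (x', y') \<longleftrightarrow> x < x' \<and> x' < y \<and> y < y' \<or> x' < x \<and> x < y' \<and> y' < y"
  unfolding crossing_def separated_iff[OF assms] nested_iff[OF assms]
  using assms by (auto simp: vertex_disjoint_def edge_verts_def)

lemma crossing_commute: "crossing e f \<Longrightarrow> crossing f e"
  unfolding crossing_def vertex_disjoint_def separated_def nested_def by (metis inf_commute)

lemma crossing_neq: "crossing e f \<Longrightarrow> e \<noteq> f"
  by (auto simp: crossing_def vertex_disjoint_def edge_verts_def)

text \<open>The parts are the classes of the relation of being equal or crossing, so once nested
  pairs are excluded the existence of a partition amounts to transitivity of crossing. This pairwise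
  form passes easily to subsets and preimages.\<close>

lemma strongly_non_nested_matching_iff:
  "strongly_non_nested_matching M \<longleftrightarrow> matching M
     \<and> (\<forall>e\<in>M. \<forall>f\<in>M. e \<noteq> f \<longrightarrow> crossing e f \<or> separated e f)
     \<and> (\<forall>e\<in>M. \<forall>f\<in>M. \<forall>g\<in>M. crossing e f \<and> crossing f g \<and> e \<noteq> g \<longrightarrow> crossing e g)"
  (is "_ \<longleftrightarrow> _ \<and> ?sep \<and> ?trans")
proof
  assume "strongly_non_nested_matching M"
  then obtain P where M: "matching M" and P: "partition_on M P"
    and pw: "pairwise (\<lambda>e f. crossing e f \<longleftrightarrow> (\<exists>C \<in> P. e \<in> C \<and> f \<in> C)) M"
    and sp: "\<forall>C \<in> P. \<forall>D \<in> P. C \<noteq> D \<longrightarrow> (\<forall>e \<in> C. \<forall>f \<in> D. separated e f)"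
    unfolding strongly_non_nested_matching_def by (elim conjE exE)
  have cr: "crossing e f \<longleftrightarrow> (\<exists>C \<in> P. e \<in> C \<and> f \<in> C)" if "e \<in> M" "f \<in> M" "e \<noteq> f" for e f
    using pw that by (simp add: pairwise_def)
  have part: "\<exists>C\<in>P. e \<in> C" if "e \<in> M" for e
    using P that unfolding partition_on_def by blast
  have same: "C = D" if "C \<in> P" "D \<in> P" "e \<in> C" "e \<in> D" for C D e
    using P that unfolding partition_on_def disjoint_def by blast
  have ?sep
  proof (intro ballI impI)
    fix e f assume "e \<in> M" "f \<in> M" "e \<noteq> f"
    moreover from this obtain C D where "C \<in> P" "D \<in> P" "e \<in> C" "f \<in> D"
      using part by blast
    ultimately show "crossing e f \<or> separated e f"
      using cr sp by (cases "C = D") auto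
  qed
  moreover have ?trans
  proof (intro ballI impI, elim conjE)
    fix e f g
    assume efg: "e \<in> M" "f \<in> M" "g \<in> M" "crossing e f" "crossing f g" "e \<noteq> g"
    obtain C where C: "C \<in> P" "e \<in> C" "f \<in> C"
      using cr[of e f] efg crossing_neq by blast
    obtain D where D: "D \<in> P" "f \<in> D" "g \<in> D"
      using cr[of f g] efg crossing_neq by blast
    have "C = D"
      using same[OF C(1) D(1) C(3) D(2)] .
    then show "crossing e g"
      using cr[of e g] efg C D by blast
  qed
  ultimately show "matching M \<and> ?sep \<and> ?trans"
    using M by blast
next
  assume asm: "matching M \<and> ?sep \<and> ?trans"
  note mM = asm[THEN conjunct1] and sepM = asm[THEN conjunct2, THEN conjunct1]
    and transM = asm[THEN conjunct2, THEN conjunct2]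
  define r where "r = {(e, f). e \<in> M \<and> f \<in> M \<and> (e = f \<or> crossing e f)}"
  have "trans r"
    unfolding trans_def r_def using transM by blast
  moreover have "sym r"
    unfolding sym_def r_def using crossing_commute by blast
  moreover have "refl_on M r" "r \<subseteq> M \<times> M"
    by (auto simp: refl_on_def r_def)
  ultimately have eq: "equiv M r"
    by (simp add: equiv_def)
  have cls: "e \<in> C \<Longrightarrow> f \<in> C \<Longrightarrow> (e, f) \<in> r" if "C \<in> M // r" for C e f
    using quotient_eq_iff[OF eq that that] by blast
  have cls': "\<exists>C\<in>M // r. e \<in> C \<and> f \<in> C" if "(e, f) \<in> r" for e f
  proof (rule bexI)
    show "e \<in> r `` {e} \<and> f \<in> r `` {e}"
      using that by (auto simp: r_def)
    show "r `` {e} \<in> M // r"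
      using that by (intro quotientI) (auto simp: r_def)
  qed
  have sub: "C \<subseteq> M" if "C \<in> M // r" for C
    using in_quotient_imp_subset[OF eq that] .
  have "crossing_matching C" if "C \<in> M // r" for C
  proof -
    have "matching C"
      using mM sub[OF that] unfolding matching_def
      by (blast intro: finite_subset pairwise_subset)
    moreover have "pairwise crossing C"
      using cls[OF that] by (auto simp: pairwise_def r_def)
    ultimately show ?thesis
      by (simp add: crossing_matching_def)
  qed
  moreover have "pairwise (\<lambda>e f. crossing e f \<longleftrightarrow> (\<exists>C \<in> M // r. e \<in> C \<and> f \<in> C)) M"
    unfolding pairwise_def
  proof (intro ballI impI)
    fix e f assume ef: "e \<in> M" "f \<in> M" "e \<noteq> f"
    then have "crossing e f \<longleftrightarrow> (e, f) \<in> r"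
      by (auto simp: r_def)
    moreover have "(e, f) \<in> r \<longleftrightarrow> (\<exists>C \<in> M // r. e \<in> C \<and> f \<in> C)"
    proof
      assume "(e, f) \<in> r"
      then show "\<exists>C \<in> M // r. e \<in> C \<and> f \<in> C"
        by (rule cls')
    next
      assume "\<exists>C \<in> M // r. e \<in> C \<and> f \<in> C"
      then obtain C where "C \<in> M // r" "e \<in> C" "f \<in> C"
        by (elim bexE conjE)
      then show "(e, f) \<in> r"
        by (rule cls)
    qed
    ultimately show "crossing e f \<longleftrightarrow> (\<exists>C \<in> M // r. e \<in> C \<and> f \<in> C)"
      by (rule trans)
  qed
  moreover have "separated e f"
    if "C \<in> M // r" "D \<in> M // r" "C \<noteq> D" "e \<in> C" "f \<in> D" for C D e f
  proof -
    have "(e, f) \<notin> r"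
      using that(3) quotient_eq_iff[OF eq that(1,2,4,5)] by simp
    moreover have "e \<in> M" "f \<in> M"
      using sub[OF that(1)] sub[OF that(2)] that(4,5) by auto
    ultimately have "e \<noteq> f" "\<not> crossing e f"
      by (simp_all add: r_def)
    then show ?thesis
      using sepM \<open>e \<in> M\<close> \<open>f \<in> M\<close> by blast
  qed
  ultimately show "strongly_non_nested_matching M"
    unfolding strongly_non_nested_matching_def
    using mM partition_on_quotient[OF eq] by (intro conjI exI[of _ "M // r"]) simp_all
qed

lemma matching_subset: "matching M \<Longrightarrow> N \<subseteq> M \<Longrightarrow> matching N"
  unfolding matching_def by (blast intro: finite_subset pairwise_subset)

lemma strongly_non_nested_matching_subset:
  "strongly_non_nested_matching M \<Longrightarrow> N \<subseteq> M \<Longrightarrow> strongly_non_nested_matching N"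
  unfolding strongly_non_nested_matching_iff using matching_subset by blast

section \<open>From chains to strongly non-nested matchings\<close>

text \<open>All spans contain both \<open>p\<close> and \<open>p + 1\<close>, so no two are
  separated, and strict increase in both coordinates rules out nesting.\<close>

lemma crossing_chain:
  assumes "finite C" "strict_chain C" "\<And>x y. (x, y) \<in> C \<Longrightarrow> x \<le> p \<and> p < y"
  shows "crossing_matching C"
proof -
  have "crossing e f" if "e \<in> C" "f \<in> C" "e \<noteq> f" for e f
  proof -
    obtain x y x' y' where [simp]: "e = (x, y)" "f = (x', y')"
      by fastforce
    have "x \<le> p" "p < y" "x' \<le> p" "p < y'"
      using assms(3) that by auto
    moreover have "x < x' \<and> y < y' \<or> x' < x \<and> y' < y"
      using assms(2) that unfolding strict_chain_def pairwise_def by fastforce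
    ultimately show ?thesis
      by (auto simp: crossing_iff)
  qed
  then show ?thesis
    using assms(1,3) by (fastforce simp: crossing_matching_def matching_def pairwise_def crossing_def)
qed

lemma strongly_non_nested_matching_crossing:
  "crossing_matching C \<Longrightarrow> strongly_non_nested_matching C"
  unfolding strongly_non_nested_matching_iff crossing_matching_def pairwise_def by blast

lemma strongly_non_nested_matching_Un:
  assumes A: "crossing_matching A" and B: "strongly_non_nested_matching B"
    and AB: "\<And>e f. e \<in> A \<Longrightarrow> f \<in> B \<Longrightarrow> snd e < fst f"
  shows "strongly_non_nested_matching (A \<union> B)"
proof -
  have mA: "matching A" and mB: "matching B"
    using A B by (auto simp: crossing_matching_def strongly_non_nested_matching_iff)
  have lt: "fst e < snd e" if "e \<in> A \<union> B" for e
    using that mA mB by (auto simp: matching_def)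
  have sep: "separated e f \<and> separated f e \<and> \<not> crossing e f \<and> \<not> crossing f e" if "e \<in> A" "f \<in> B" for e f
  proof -
    have "separated e f" "separated f e"
      using AB[OF that] lt[of e] lt[of f] that by (cases e; cases f; simp add: separated_iff)+
    then show ?thesis
      by (simp add: crossing_def)
  qed
  have m: "matching (A \<union> B)"
    unfolding matching_def
  proof (intro conjI)
    show "finite (A \<union> B)"
      using mA mB by (simp add: matching_def)
    show "\<forall>(x, y)\<in>A \<union> B. x < y"
      using lt by auto
    show "pairwise vertex_disjoint (A \<union> B)"
      using mA mB sep unfolding matching_def pairwise_def separated_def by blast
  qed
  have cA: "crossing e f" if "e \<in> A" "f \<in> A" "e \<noteq> f" for e f
    using A that by (auto simp: crossing_matching_def pairwise_def)
  have sB: "crossing e f \<or> separated e f" if "e \<in> B" "f \<in> B" "e \<noteq> f" for e f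
    using B that unfolding strongly_non_nested_matching_iff by blast
  have tB: "crossing e g"
    if "e \<in> B" "f \<in> B" "g \<in> B" "crossing e f" "crossing f g" "e \<noteq> g" for e f g
    using B that unfolding strongly_non_nested_matching_iff by blast
  show ?thesis
    unfolding strongly_non_nested_matching_iff
  proof (intro conjI ballI impI m)
    fix e f assume "e \<in> A \<union> B" "f \<in> A \<union> B" "e \<noteq> f"
    then show "crossing e f \<or> separated e f"
      using cA[of e f] sB[of e f] sep[of e f] sep[of f e] by auto
  next
    fix e f g
    assume "e \<in> A \<union> B" "f \<in> A \<union> B" "g \<in> A \<union> B" "crossing e f \<and> crossing f g \<and> e \<noteq> g"
    then show "crossing e g"
      using cA[of e g] tB[of e f g] sep[of e f] sep[of f e] sep[of f g] sep[of g f] by auto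
  qed
qed

text \<open>
  Cut the chain greedily into crossing blocks; then blocks at distance at least two are separated, so
  the odd and the even blocks form the two matchings. The last conjunct keeps the induction going.
\<close>

lemma strict_chain_split:
  assumes "finite C" "strict_chain C" "\<And>e. e \<in> C \<Longrightarrow> fst e < snd e"
  shows "\<exists>A B. C = A \<union> B \<and> strongly_non_nested_matching A \<and> strongly_non_nested_matching B
    \<and> (\<forall>b\<in>B. \<forall>m\<in>C. (\<forall>c\<in>C. fst m \<le> fst c) \<longrightarrow> snd m \<le> fst b)"
  using assms
proof (induction "card C" arbitrary: C rule: less_induct)
  case less
  show ?case
  proof (cases "C = {}")
    case True
    have "strongly_non_nested_matching {}"
      by (simp add: strongly_non_nested_matching_iff matching_def)
    then show ?thesis
      using True by blast
  next
    case False
    then obtain m where m: "m \<in> C" "\<forall>c\<in>C. fst m \<le> fst c"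
      using less.prems(1) arg_min_if_finite(1)[of C fst] arg_min_least[of C _ fst] by metis
    have cmp: "fst e < fst f \<and> snd e < snd f \<or> fst f < fst e \<and> snd f < snd e"
      if "e \<in> C" "f \<in> C" "e \<noteq> f" for e f
      using less.prems(2) that unfolding strict_chain_def pairwise_def by blast
    have m_uniq: "m' = m" if "m' \<in> C" "\<forall>c\<in>C. fst m' \<le> fst c" for m'
      using cmp[OF that(1) m(1)] m that by force
    define K where "K = {c \<in> C. fst c < snd m}"
    define D where "D = {c \<in> C. snd m \<le> fst c}"
    have C: "C = K \<union> D" "K \<inter> D = {}"
      by (auto simp: K_def D_def)
    have mK: "m \<in> K"
      using m less.prems(3) by (simp add: K_def)
    have fin: "finite K" "finite D"
      using less.prems(1) C by auto
    have "card D < card C"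
      using C(2) mK m(1) less.prems(1) by (intro psubset_card_mono) (auto simp: D_def)
    moreover have "strict_chain D" "strict_chain K"
      using less.prems(2) C strict_chain_subset by blast+
    ultimately obtain A B where AB: "D = A \<union> B"
      "strongly_non_nested_matching A" "strongly_non_nested_matching B"
      "\<forall>b\<in>B. \<forall>d\<in>D. (\<forall>c\<in>D. fst d \<le> fst c) \<longrightarrow> snd d \<le> fst b"
      using less.hyps[of D] fin less.prems(3) C by blast
    \<comment> \<open>The edges of the first block \<open>K\<close> start before
      \<open>snd m\<close> and end no earlier than it, hence the cut at
      \<open>snd m - 1\<close>.\<close>
    have "crossing_matching K"
    proof (rule crossing_chain[OF fin(1) \<open>strict_chain K\<close>])
      fix x y assume xy: "(x, y) \<in> K"
      then have "(x, y) \<in> C" "fst m \<le> x"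
        using m by (auto simp: K_def)
      then have "snd m \<le> y"
        using cmp[OF _ m(1), of "(x, y)"] by (cases "(x, y) = m") auto
      then show "x \<le> snd m - 1 \<and> snd m - 1 < y"
        using xy less.prems(3)[OF m(1)] by (auto simp: K_def)
    qed
    \<comment> \<open>The two matchings swap roles: \<open>K\<close> joins \<open>B\<close>. The
      first edge \<open>d\<close> of the rest ends after \<open>e\<close> and, by the invariant, no
      later than \<open>b\<close> starts.\<close>
    moreover have "snd e < fst b" if "e \<in> K" "b \<in> B" for e b
    proof -
      have "D \<noteq> {}"
        using that AB by blast
      then obtain d where d: "d \<in> D" "\<forall>c\<in>D. fst d \<le> fst c"
        using fin(2) arg_min_if_finite(1)[of D fst] arg_min_least[of D _ fst] by metis
      have "e \<in> C" "d \<in> C" "fst e < fst d"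
        using that(1) d(1) by (auto simp: K_def D_def)
      then have "snd e < snd d"
        using cmp[of e d] by auto
      also have "snd d \<le> fst b"
        using AB(4) that d by blast
      finally show ?thesis .
    qed
    ultimately have "strongly_non_nested_matching (K \<union> B)"
      using AB(3) by (intro strongly_non_nested_matching_Un)
    moreover have "\<forall>b\<in>A. \<forall>m'\<in>C. (\<forall>c\<in>C. fst m' \<le> fst c) \<longrightarrow> snd m' \<le> fst b"
    proof (intro ballI impI)
      fix b m' assume "b \<in> A" "m' \<in> C" "\<forall>c\<in>C. fst m' \<le> fst c"
      then have "m' = m" "b \<in> D"
        using m_uniq AB(1) by blast+
      then show "snd m' \<le> fst b"
        by (simp add: D_def)
    qed
    moreover have "C = (K \<union> B) \<union> A"
      using C AB(1) by auto
    ultimately show ?thesis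
      using AB(2) by blast
  qed
qed

lemma card_le_of_no_strongly_non_nested:
  assumes E: "ordered_graph (n, E)" and k: "1 \<le> k" "2 * k \<le> n"
    and no: "\<And>M. M \<subseteq> E \<Longrightarrow> strongly_non_nested_matching M \<Longrightarrow> card M \<noteq> k"
  shows "card E \<le> (k - 1) * n + ((k - 1) choose 2)"
proof (rule card_le_of_chain_bounds)
  show E': "E \<subseteq> {(x, y). 1 \<le> x \<and> x < y \<and> y \<le> n}"
    using E by (simp add: ordered_graph_def)
  have fE: "finite E"
    by (rule finite_subset[of _ "{..n} \<times> {..n}"]) (use E' in auto)
  have snn: "card M \<le> k - 1" if M: "M \<subseteq> E" "strongly_non_nested_matching M" for M
  proof (rule ccontr)
    assume "\<not> card M \<le> k - 1"
    then have "k \<le> card M"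
      by simp
    then obtain N where "N \<subseteq> M" "card N = k"
      by (rule obtain_subset_with_card_n)
    then show False
      using no[of N] M strongly_non_nested_matching_subset by blast
  qed
  show "card C \<le> k - 1" if "C \<subseteq> E" "strict_chain C" "\<And>x y. (x, y) \<in> C \<Longrightarrow> x \<le> p \<and> p < y" for C p
    using that fE
    by (intro snn strongly_non_nested_matching_crossing crossing_chain) (auto intro: finite_subset)
  show "card C \<le> 2 * (k - 1)" if C: "C \<subseteq> E" "strict_chain C" for C
  proof -
    obtain A B where "C = A \<union> B" "strongly_non_nested_matching A" "strongly_non_nested_matching B"
      using strict_chain_split[OF finite_subset[OF C(1) fE] C(2)] C(1) E' by force
    then show ?thesis
      using card_Un_le[of A B] snn[of A] snn[of B] C(1) by simp
  qed
qed (use k in simp)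

section \<open>The extremal function\<close>

text \<open>Crossing and separation depend only on the order of the endpoints, which
  \<open>f\<close> preserves and reflects, so the pairwise characterisation pulls back.\<close>

lemma strongly_non_nested_matching_preimage:
  assumes f: "strict_mono_on A (f :: nat \<Rightarrow> nat)" and M: "strongly_non_nested_matching M"
    and M0: "finite M0" "M0 \<subseteq> A \<times> A" "\<And>x y. (x, y) \<in> M0 \<Longrightarrow> (f x, f y) \<in> M"
  shows "strongly_non_nested_matching M0"
proof -
  let ?g = "map_prod f f"
  have inj: "x = y" if "x \<in> A" "y \<in> A" "f x = f y" for x y
    using strict_mono_on_imp_inj_on[OF f] that by (auto dest: inj_onD)
  have less: "f x < f y \<longleftrightarrow> x < y" if "x \<in> A" "y \<in> A" for x y
    using f that strict_mono_on_less by blast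
  have g: "?g e \<in> M" if "e \<in> M0" for e
    using M0(3) that by (cases e) auto
  have ltM: "x < y" if "(x, y) \<in> M" for x y
    using M that by (auto simp: strongly_non_nested_matching_iff matching_def)
  have lt: "x < y" if "(x, y) \<in> M0" for x y
    using ltM[OF M0(3)[OF that]] less that M0(2) by auto
  have g_neq: "?g e \<noteq> ?g e'" if "e \<in> M0" "e' \<in> M0" "e \<noteq> e'" for e e'
    using that M0(2) inj by (cases e; cases e') auto
  have cr: "crossing (?g e) (?g e') \<longleftrightarrow> crossing e e'" if "e \<in> M0" "e' \<in> M0" for e e'
  proof -
    obtain x y x' y' where e: "e = (x, y)" "e' = (x', y')"
      by fastforce
    have "x \<in> A" "y \<in> A" "x' \<in> A" "y' \<in> A"
      using that M0(2) e by auto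
    moreover have "x < y" "x' < y'" "f x < f y" "f x' < f y'"
      using that lt M0(3) ltM e by auto
    ultimately show ?thesis
      by (simp add: e crossing_iff less)
  qed
  have sep: "separated (?g e) (?g e') \<longleftrightarrow> separated e e'" if "e \<in> M0" "e' \<in> M0" for e e'
  proof -
    obtain x y x' y' where e: "e = (x, y)" "e' = (x', y')"
      by fastforce
    have "x \<in> A" "y \<in> A" "x' \<in> A" "y' \<in> A"
      using that M0(2) e by auto
    moreover have "x < y" "x' < y'" "f x < f y" "f x' < f y'"
      using that lt M0(3) ltM e by auto
    ultimately show ?thesis
      by (simp add: e separated_iff less)
  qed
  have sepM: "crossing e e' \<or> separated e e'" if "e \<in> M" "e' \<in> M" "e \<noteq> e'" for e e'
    using M that unfolding strongly_non_nested_matching_iff by blast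
  have trM: "crossing e e''"
    if "e \<in> M" "e' \<in> M" "e'' \<in> M" "crossing e e'" "crossing e' e''" "e \<noteq> e''" for e e' e''
    using M that unfolding strongly_non_nested_matching_iff by blast
  have sep0: "crossing e e' \<or> separated e e'" if "e \<in> M0" "e' \<in> M0" "e \<noteq> e'" for e e'
    using sepM[OF g g g_neq] cr sep that by blast
  have "matching M0"
    unfolding matching_def
  proof (intro conjI M0(1))
    show "\<forall>(x, y)\<in>M0. x < y"
      using lt by auto
    show "pairwise vertex_disjoint M0"
      using sep0 by (auto simp: pairwise_def crossing_def separated_def)
  qed
  moreover have "crossing e e''"
    if "e \<in> M0" "e' \<in> M0" "e'' \<in> M0" "crossing e e'" "crossing e' e''" "e \<noteq> e''" for e e' e''
    using trM[OF g[OF that(1)] g[OF that(2)] g[OF that(3)] _ _ g_neq[OF that(1,3,6)]]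
      cr[OF that(1,2)] cr[OF that(2,3)] cr[OF that(1,3)] that(4,5) by simp
  ultimately show ?thesis
    unfolding strongly_non_nested_matching_iff using sep0 by blast
qed

lemma card_matching_vertices:
  assumes "matching M"
  shows "card (fst ` M \<union> snd ` M) = 2 * card M"
proof -
  have vd: "vertex_disjoint e f" if "e \<in> M" "f \<in> M" "e \<noteq> f" for e f
    using assms that by (auto simp: matching_def pairwise_def)
  have lt: "fst e < snd e" if "e \<in> M" for e
    using assms that by (auto simp: matching_def)
  have "inj_on fst M" "inj_on snd M"
    using vd by (force simp: inj_on_def vertex_disjoint_def edge_verts_def)+
  moreover have "fst ` M \<inter> snd ` M = {}"
  proof -
    have "fst e \<noteq> snd f" if "e \<in> M" "f \<in> M" for e f
      using vd[OF that] lt[OF that(1)] by (cases "e = f") (auto simp: vertex_disjoint_def edge_verts_def)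
    then show ?thesis
      by auto
  qed
  moreover have "finite M"
    using assms by (simp add: matching_def)
  ultimately show ?thesis
    by (simp add: card_Un_disjoint card_image)
qed

lemma ex_strict_mono_on_enumeration:
  assumes "finite (V :: nat set)"
  shows "\<exists>f. strict_mono_on {1..card V} f \<and> f ` {1..card V} = V"
proof -
  let ?l = "sorted_list_of_set V"
  define f where "f i = ?l ! (i - 1)" for i
  have "strict_mono_on {1..card V} f"
    using assms
    by (auto simp: strict_mono_on_def f_def intro!: sorted_wrt_nth_less[OF strict_sorted_list_of_set])
  moreover have "f ` {1..card V} = V"
  proof -
    have "v \<in> f ` {1..card V}" if "v \<in> V" for v
    proof -
      have "v \<in> set ?l"
        using assms that by simp
      then obtain i where i: "i < card V" "?l ! i = v"
        unfolding in_set_conv_nth using assms by auto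
      then show ?thesis
        by (intro image_eqI[of _ _ "Suc i"]) (simp_all add: f_def)
    qed
    moreover have "f i \<in> V" if "i \<in> {1..card V}" for i
    proof -
      have "?l ! (i - 1) \<in> set ?l"
        using assms that by (intro nth_mem) auto
      then show ?thesis
        using assms by (simp add: f_def)
    qed
    ultimately show ?thesis
      by auto
  qed
  ultimately show ?thesis
    by blast
qed

text \<open>Number the \<open>2 * k\<close> endpoints of \<open>M\<close> increasingly; the pullback
  of \<open>M\<close> along this numbering is the required member of the family.\<close>

lemma contains_copy_of_strongly_non_nested:
  assumes E: "ordered_graph (n, E)" and M: "M \<subseteq> E" "strongly_non_nested_matching M" "card M = k"
  shows "\<exists>H\<in>strongly_non_nested_family k. contains_copy (n, E) H"
proof -
  have mM: "matching M"
    using M(2) by (simp add: strongly_non_nested_matching_iff)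
  define V where "V = fst ` M \<union> snd ` M"
  have fV: "finite V"
    using mM by (simp add: V_def matching_def)
  have cV: "card V = 2 * k"
    using card_matching_vertices[OF mM] M(3) by (simp add: V_def)
  obtain f where f: "strict_mono_on {1..2 * k} f" "f ` {1..2 * k} = V"
    using ex_strict_mono_on_enumeration[OF fV] cV by auto
  have inj: "inj_on f {1..2 * k}"
    using f(1) by (rule strict_mono_on_imp_inj_on)
  define M0 where "M0 = {(x, y). x \<in> {1..2 * k} \<and> y \<in> {1..2 * k} \<and> (f x, f y) \<in> M}"
  have M0: "M0 \<subseteq> {1..2 * k} \<times> {1..2 * k}"
    by (auto simp: M0_def)
  then have fin: "finite M0"
    by (rule finite_subset) simp
  have snn: "strongly_non_nested_matching M0"
    using strongly_non_nested_matching_preimage[OF f(1) M(2) fin M0] by (simp add: M0_def)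
  have "map_prod f f ` M0 = M"
  proof -
    have "e \<in> map_prod f f ` M0" if "e \<in> M" for e
    proof -
      have "fst e \<in> f ` {1..2 * k}" "snd e \<in> f ` {1..2 * k}"
        unfolding f(2) V_def using that by auto
      then obtain x y where "x \<in> {1..2 * k}" "y \<in> {1..2 * k}" "e = (f x, f y)"
        by (metis imageE prod.collapse)
      then show ?thesis
        using that by (intro image_eqI[of _ _ "(x, y)"]) (auto simp: M0_def)
    qed
    then show ?thesis
      by (auto simp: M0_def)
  qed
  moreover have "inj_on (map_prod f f) M0"
    using map_prod_inj_on[OF inj inj] M0 by (rule inj_on_subset)
  ultimately have "card M0 = k"
    using card_image M(3) by metis
  moreover have "ordered_graph (2 * k, M0)"
    using snn by (auto simp: ordered_graph_def M0_def strongly_non_nested_matching_iff matching_def)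
  ultimately have "(2 * k, M0) \<in> strongly_non_nested_family k"
    using snn by (simp add: strongly_non_nested_family_def)
  moreover have "contains_copy (n, E) (2 * k, M0)"
  proof -
    have "V \<subseteq> {1..n}"
      using M(1) E by (force simp: V_def ordered_graph_def)
    then show ?thesis
      unfolding contains_copy_def using f M(1) by (auto simp: M0_def intro!: exI[of _ f])
  qed
  ultimately show ?thesis
    by blast
qed

lemma strongly_non_nested_family_subset: "strongly_non_nested_family k \<subseteq> non_nested_family k"
proof -
  have "non_nested_matching M" if "strongly_non_nested_matching M" for M
  proof -
    have m: "matching M"
      and cs: "\<forall>e\<in>M. \<forall>f\<in>M. e \<noteq> f \<longrightarrow> crossing e f \<or> separated e f"
      using that unfolding strongly_non_nested_matching_iff by blast+
    have "\<not> nested e f" if "e \<in> M" "f \<in> M" "e \<noteq> f" for e f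
    proof -
      have "crossing e f \<or> separated e f"
        using cs that by blast
      moreover have "fst e < snd e" "fst f < snd f"
        using m that by (auto simp: matching_def)
      ultimately show ?thesis
        by (cases e; cases f) (auto simp: crossing_iff separated_iff nested_iff)
    qed
    then show ?thesis
      using m by (simp add: non_nested_matching_def pairwise_def)
  qed
  then show ?thesis
    by (auto simp: strongly_non_nested_family_def non_nested_family_def)
qed

section \<open>Monotonicity and bounds for the extremal function\<close>

lemma finite_edge_counts:
  "finite {card E |E. ordered_graph (n, E) \<and> Q E}"
proof (rule finite_subset)
  have "{(x, y). 1 \<le> x \<and> x < y \<and> y \<le> n} \<subseteq> {..n} \<times> {..n}"
    by auto
  then show "{card E |E. ordered_graph (n, E) \<and> Q E} \<subseteq> card ` Pow ({..n} \<times> {..n})"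
    unfolding ordered_graph_def by force
qed simp

text \<open>Forbidding fewer ordered graphs admits more. As every member has an edge, the empty
  graph avoids the family and the maximum is over a nonempty set.\<close>

lemma ex_ord_mono:
  assumes "\<G> \<subseteq> \<H>" "\<And>H. H \<in> \<H> \<Longrightarrow> snd H \<noteq> {}"
  shows "ex_ord n \<H> \<le> ex_ord n \<G>"
  unfolding ex_ord_def
proof (rule Max_mono)
  have "ordered_graph (n, {}) \<and> (\<forall>H\<in>\<H>. \<not> contains_copy (n, {}) H)"
    using assms(2) by (force simp: ordered_graph_def contains_copy_def)
  then show "{card E |E. ordered_graph (n, E) \<and> (\<forall>H\<in>\<H>. \<not> contains_copy (n, E) H)} \<noteq> {}"
    by blast
  show "{card E |E. ordered_graph (n, E) \<and> (\<forall>H\<in>\<H>. \<not> contains_copy (n, E) H)}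
    \<subseteq> {card E |E. ordered_graph (n, E) \<and> (\<forall>H\<in>\<G>. \<not> contains_copy (n, E) H)}"
    using assms(1) by blast
qed (rule finite_edge_counts)

lemma card_le_ex_ord:
  assumes "ordered_graph (n, E)" "\<And>H. H \<in> \<H> \<Longrightarrow> \<not> contains_copy (n, E) H"
  shows "card E \<le> ex_ord n \<H>"
  unfolding ex_ord_def using assms by (intro Max_ge[OF finite_edge_counts]) blast

lemma ex_ord_le:
  assumes "\<And>E. ordered_graph (n, E) \<Longrightarrow> (\<And>H. H \<in> \<H> \<Longrightarrow> \<not> contains_copy (n, E) H) \<Longrightarrow> card E \<le> b"
    and "\<And>H. H \<in> \<H> \<Longrightarrow> snd H \<noteq> {}"
  shows "ex_ord n \<H> \<le> b"
  unfolding ex_ord_def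
proof (rule Max.boundedI[OF finite_edge_counts])
  have "ordered_graph (n, {}) \<and> (\<forall>H\<in>\<H>. \<not> contains_copy (n, {}) H)"
    using assms(2) by (force simp: ordered_graph_def contains_copy_def)
  then show "{card E |E. ordered_graph (n, E) \<and> (\<forall>H\<in>\<H>. \<not> contains_copy (n, E) H)} \<noteq> {}"
    by blast
  show "a \<le> b" if "a \<in> {card E |E. ordered_graph (n, E) \<and> (\<forall>H\<in>\<H>. \<not> contains_copy (n, E) H)}" for a
    using that assms(1) by blast
qed

section \<open>The lower bound construction\<close>

definition hub_graph :: "nat \<Rightarrow> nat \<Rightarrow> edge set" where
  "hub_graph n k = {(x, y). 1 \<le> x \<and> x < y \<and> y \<le> n \<and> (x < k \<or> y < 2 * k)}"

lemma card_hub_graph: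
  assumes "2 * k \<le> n"
  shows "(k - 1) * n \<le> card (hub_graph n k)"
proof -
  \<comment> \<open>Hub \<open>i\<close> and vertex \<open>y\<close> form an edge themselves if
    \<open>i < y\<close>. The leftover pairs with \<open>y \<le> i < k\<close> are shifted
    injectively into the clique on \<open>{k..2 * k - 1}\<close>, the \<open>- 1\<close> making the
    order strict.\<close>
  define g where "g = (\<lambda>(i, y). if i < y then (i, y) else (y + k - 1, i + k :: nat))"
  have "card ({1..<k} \<times> {1..n}) \<le> card (hub_graph n k)"
  proof (rule card_inj_on_le)
    show "inj_on g ({1..<k} \<times> {1..n})"
      by (auto simp: inj_on_def g_def split: if_splits)
    show "g ` ({1..<k} \<times> {1..n}) \<subseteq> hub_graph n k"
      using assms by (auto simp: g_def hub_graph_def split: if_splits)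
    show "finite (hub_graph n k)"
      by (rule finite_subset[of _ "{..n} \<times> {..n}"]) (auto simp: hub_graph_def)
  qed
  then show ?thesis
    by (simp add: card_cartesian_product)
qed

lemma strict_mono_on_ge:
  assumes "strict_mono_on {1..m} f" "f ` {1..m} \<subseteq> {1..(n :: nat)}" "i \<in> {1..m}"
  shows "i \<le> f i"
  using assms(3)
proof (induction i)
  case (Suc i)
  show ?case
  proof (cases i)
    case 0
    then show ?thesis
      using assms(2) Suc.prems by force
  next
    case (Suc j)
    then have "f i < f (Suc i)"
      using assms(1) Suc.prems by (auto intro: strict_mono_onD)
    then show ?thesis
      using Suc.IH Suc.prems Suc by simp
  qed
qed simp

text \<open>Take the edge \<open>(x0, y0)\<close> of \<open>M\<close> with the largest left end.
  There are \<open>k\<close> left ends, so \<open>k \<le> x0 \<le> f x0\<close>; the image does not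
  start at a hub and thus ends before \<open>2 * k\<close>, whence \<open>y0 < 2 * k\<close>.
  Without nesting \<open>y0\<close> is also the largest right end, so all \<open>2 * k\<close>
  vertices of \<open>M\<close> would lie in \<open>{1..y0}\<close>.\<close>

lemma hub_graph_avoids:
  assumes "1 \<le> k" "H \<in> non_nested_family k"
  shows "\<not> contains_copy (n, hub_graph n k) H"
proof
  assume copy: "contains_copy (n, hub_graph n k) H"
  obtain M where H: "H = (2 * k, M)"
    and M: "ordered_graph (2 * k, M)" "card M = k" "non_nested_matching M"
    using assms(2) by (auto simp: non_nested_family_def)
  obtain f where f: "strict_mono_on {1..2 * k} f" "f ` {1..2 * k} \<subseteq> {1..n}"
    and fM': "\<forall>(x, y)\<in>M. (f x, f y) \<in> hub_graph n k"
    using copy unfolding contains_copy_def H fst_conv snd_conv by (elim exE conjE)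
  have fM: "(f x, f y) \<in> hub_graph n k" if "(x, y) \<in> M" for x y
    using fM' that by blast
  have mM: "matching M" and nn: "\<And>e e'. e \<in> M \<Longrightarrow> e' \<in> M \<Longrightarrow> e \<noteq> e' \<Longrightarrow> \<not> nested e e'"
    using M(3) by (auto simp: non_nested_matching_def pairwise_def)
  have range: "1 \<le> x \<and> x < y \<and> y \<le> 2 * k" if "(x, y) \<in> M" for x y
    using M(1) that by (auto simp: ordered_graph_def)
  have fin: "finite M"
    using mM by (simp add: matching_def)
  have vd: "vertex_disjoint e e'" if "e \<in> M" "e' \<in> M" "e \<noteq> e'" for e e'
    using mM that by (auto simp: matching_def pairwise_def)
  have "M \<noteq> {}"
    using M(2) assms(1) by auto
  then have "Max (fst ` M) \<in> fst ` M"
    using fin by (intro Max_in) auto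
  then obtain x0 y0 where e0: "(x0, y0) \<in> M" "x0 = Max (fst ` M)"
    by auto
  have le: "x \<le> x0" if "(x, y) \<in> M" for x y
    unfolding e0(2) using fin that by (intro Max_ge) (auto intro: rev_image_eqI)
  have "inj_on fst M"
    using vd by (force simp: inj_on_def vertex_disjoint_def edge_verts_def)
  then have "k = card (fst ` M)"
    using M(2) by (simp add: card_image)
  also have "\<dots> \<le> card {1..x0}"
    using le range by (intro card_mono) force+
  finally have "k \<le> x0"
    by simp
  also have "x0 \<le> f x0"
    using strict_mono_on_ge[OF f] range[OF e0(1)] by simp
  finally have "f y0 < 2 * k"
    using fM[OF e0(1)] by (auto simp: hub_graph_def)
  moreover have "y0 \<le> f y0"
    using strict_mono_on_ge[OF f] range[OF e0(1)] by simp
  ultimately have y0: "y0 < 2 * k"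
    by simp
  have "y \<le> y0" if "(x, y) \<in> M" for x y
  proof (rule ccontr)
    assume "\<not> y \<le> y0"
    moreover from this have neq: "(x, y) \<noteq> (x0, y0)"
      by auto
    moreover have "x \<noteq> x0"
      using vd[OF that e0(1) neq] by (auto simp: vertex_disjoint_def edge_verts_def)
    ultimately have "nested (x, y) (x0, y0)"
      using le[OF that] range[OF that] range[OF e0(1)] by (simp add: nested_iff)
    then show False
      using nn[OF that e0(1) neq] by simp
  qed
  then have "fst ` M \<union> snd ` M \<subseteq> {1..y0}"
    using range by force
  then have "card (fst ` M \<union> snd ` M) \<le> y0"
    using card_mono[of "{1..y0}"] by simp
  then show False
    using card_matching_vertices[OF mM] M(2) y0 by simp
qed

theorem theorem2p2:
  fixes n k :: nat
  assumes "1 \<le> k" and "2 * k \<le> n"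
  shows "(k - 1) * n \<le> ex_ord n (non_nested_family k)
    \<and> ex_ord n (non_nested_family k) \<le> ex_ord n (strongly_non_nested_family k)
    \<and> ex_ord n (strongly_non_nested_family k) \<le> (k - 1) * n + ((k - 1) choose 2)"
proof (intro conjI)
  have ne: "snd H \<noteq> {}" if "H \<in> non_nested_family k" for H
    using that assms(1) by (auto simp: non_nested_family_def)
  have "ordered_graph (n, hub_graph n k)"
    by (auto simp: ordered_graph_def hub_graph_def)
  then have "card (hub_graph n k) \<le> ex_ord n (non_nested_family k)"
    using hub_graph_avoids[OF assms(1)] by (rule card_le_ex_ord)
  then show "(k - 1) * n \<le> ex_ord n (non_nested_family k)"
    using card_hub_graph[OF assms(2)] by linarith
  show "ex_ord n (non_nested_family k) \<le> ex_ord n (strongly_non_nested_family k)"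
    using strongly_non_nested_family_subset ne by (rule ex_ord_mono)
  show "ex_ord n (strongly_non_nested_family k) \<le> (k - 1) * n + ((k - 1) choose 2)"
  proof (rule ex_ord_le)
    fix E assume E: "ordered_graph (n, E)"
      and avoid: "\<And>H. H \<in> strongly_non_nested_family k \<Longrightarrow> \<not> contains_copy (n, E) H"
    show "card E \<le> (k - 1) * n + ((k - 1) choose 2)"
      using E assms
    proof (rule card_le_of_no_strongly_non_nested)
      show "card M \<noteq> k" if "M \<subseteq> E" "strongly_non_nested_matching M" for M
        using contains_copy_of_strongly_non_nested[OF E that] avoid by blast
    qed
  qed (use ne strongly_non_nested_family_subset in blast)
qed

end
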